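(* Let $n\ge 1$, let $G$ be a simple acyclic directed graph on the vertex set $[n]=\{1,\dots,n\}$, and let $\vec d=(d_1,\dots,d_n)\in\mathbb{Z}_{\ge 1}^n$. If one of the following holds: (1) the entries of $\vec d$ are pairwise coprime (and $G$ is arbitrary); (2) $G$ is a directed path of length $n-1$ (and $\vec d$ is arbitrary); (3) $G$ contains a directed path of length $n-1$ and $\vec d=(m,m,\dots,m)$ for some integer $m\ge 1$; then the matrix $A_{\vec d,G}$ has a cyclic cokernel.
   Context: For a simple acyclic directed graph $G$ on $[n]$ and $\vec d\in\mathbb{Z}_{\ge1}^n$, the directed graphical simplex is the $n\times n$ integer matrix $A_{\vec d,G}=\operatorname{diag}(d_1,\dots,d_n)+\sum_{(i,j)\in E(G)}E_{i,j}$, where $(i,j)$ denotes an edge directed from $i$ to $j$ and $E_{i,j}$ is the matrix whose only nonzero entry is a $1$ in row $i$, column $j$. A path in $G$ is a sequence of vertices $v_1\to v_2\to\dots\to v_k$ with $(v_i,v_{i+1})\in E(G)$ for $1\le i\le k-1$; its length is the number $k-1$ of edges. "$G$ is a directed path of length $n-1$" means that the edges of $G$ are exactly the $n-1$ edges of a path $v_1\to v_2\to\dots\to v_n$ visiting all vertices of $[n]$. The cokernel of $A_{\vec d,G}$ is the finite abelian group $\mathbb{Z}^n/A_{\vec d,G}\mathbb{Z}^n\cong \mathbb{Z}/\alpha_1\mathbb{Z}\oplus\dots\oplus\mathbb{Z}/\alpha_n\mathbb{Z}$, where $\operatorname{diag}(\alpha_1,\dots,\alpha_n)$ is the Smith normal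 form of $A_{\vec d,G}$. The trivial group counts as cyclic. *)

theory Defs
  imports
    "Jordan_Normal_Form.Matrix"
    "HOL-Algebra.Elementary_Groups"
    "Graph_Theory.Pair_Digraph"
    "Graph_Theory.Vertex_Walk"
begin

text \<open>Vertices are numbered \<open>1, \<dots>, n\<close>, whereas rows and columns of a
  matrix are numbered from \<open>0\<close>: vertex \<open>v\<close> corresponds to index
  \<open>v - 1\<close>.\<close>

definition matrix_unit :: "nat \<Rightarrow> nat \<Rightarrow> nat \<Rightarrow> int mat" where
  "matrix_unit n u v = mat n n (\<lambda>(r, c). if Suc r = u \<and> Suc c = v then 1 else 0)"

text \<open>The sum of matrix units over the edges is taken entrywise, because matrices of variable
  dimension do not form a type with a zero.\<close>

definition graphical_simplex :: "nat \<Rightarrow> (nat \<Rightarrow> int) \<Rightarrow> nat pair_pre_digraph \<Rightarrow> int mat" where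
  "graphical_simplex n d G =
     mat_diag n (\<lambda>r. d (Suc r)) +
     mat n n (\<lambda>rc. \<Sum>(u, v)\<in>parcs G. matrix_unit n u v $$ rc)"

definition cokernel :: "int mat \<Rightarrow> int vec set monoid" where
  "cokernel A =
     monoid_vec TYPE(int) (dim_row A) Mod ((\<lambda>x. A *\<^sub>v x) ` carrier_vec (dim_col A))"

definition is_directed_path :: "'a pair_pre_digraph \<Rightarrow> nat \<Rightarrow> bool" where
  "is_directed_path G l \<longleftrightarrow>
     (\<exists>p. vpath p (with_proj G) \<and> vwalk_length p = l \<and>
          set p = pverts G \<and> set (vwalk_arcs p) = parcs G)"

text \<open>Vertices may a priori repeat here; in an acyclic graph they cannot.\<close>

definition contains_directed_path :: "'a pair_pre_digraph \<Rightarrow> nat \<Rightarrow> bool" where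
  "contains_directed_path G l \<longleftrightarrow> (\<exists>p. vwalk p (with_proj G) \<and> vwalk_length p = l)"

lemma graphical_simplex_carrier: "graphical_simplex n d G \<in> carrier_mat n n"
  by (simp add: graphical_simplex_def)

lemma graphical_simplex_index:
  assumes "finite (parcs G)" "r < n" "c < n"
  shows "graphical_simplex n d G $$ (r, c) =
    (if r = c then d (Suc r) else 0) + (if (Suc r, Suc c) \<in> parcs G then 1 else 0)"
proof -
  have "(\<Sum>(u, v)\<in>parcs G. matrix_unit n u v $$ (r, c)) =
      (\<Sum>e\<in>parcs G. if e = (Suc r, Suc c) then 1 else 0)"
    using assms by (intro sum.cong) (auto simp: matrix_unit_def split: if_splits)
  then show ?thesis
    using assms by (auto simp: graphical_simplex_def mat_diag_def)
qed

lemma comm_group_cokernel: "comm_group (cokernel A)"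
proof -
  interpret Z: comm_group "monoid_vec TYPE(int) (dim_row A)"
    by (rule comm_group_vec)
  let ?H = "(\<lambda>x. A *\<^sub>v x) ` carrier_vec (dim_col A)"
  have A: "A \<in> carrier_mat (dim_row A) (dim_col A)" by simp
  interpret h: group_hom "monoid_vec TYPE(int) (dim_col A)" "monoid_vec TYPE(int) (dim_row A)"
    "\<lambda>x. A *\<^sub>v x"
  proof (intro group_hom.intro group_hom_axioms.intro)
    show "(\<lambda>x. A *\<^sub>v x)
        \<in> hom (monoid_vec TYPE(int) (dim_col A)) (monoid_vec TYPE(int) (dim_row A))"
      using mult_mat_vec_carrier[OF A]
      by (auto simp: hom_def monoid_vec_simps mult_add_distrib_mat_vec[OF A])
  qed (rule comm_group.axioms(2)[OF comm_group_vec])+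
  have "subgroup ?H (monoid_vec TYPE(int) (dim_row A))"
    using h.img_is_subgroup by (simp add: monoid_vec_simps)
  then show ?thesis
    unfolding cokernel_def by (rule Z.abelian_FactGroup)
qed

end

theory Submission
  imports Defs "HOL-Library.Function_Algebras"
begin

text \<open>Let \<open>M\<close> be the cokernel, with generators \<open>e\<^sub>v\<close> subject to one relation
  \<open>d\<^sub>v e\<^sub>v + \<Sum> e\<^sub>u = 0\<close> per vertex \<open>v\<close>, the sum ranging over the arcs \<open>(u, v)\<close>.

  If the \<open>d\<^sub>v\<close> are pairwise coprime, the subgroups generated by predecessor-closed sets \<open>W\<close> are
  cyclic by induction on \<open>W\<close>: if \<open>g\<close> generates the subgroup of \<open>W\<close>, if \<open>D g = 0\<close> with
  \<open>D = \<Prod>\<^sub>w d\<^sub>w\<close>, and if \<open>v\<close> is a new vertex, then \<open>g + D e\<^sub>v\<close> generates the next subgroup.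

  If there is a Hamiltonian path \<open>v\<^sub>0 \<rightarrow> \<dots> \<rightarrow> v\<^sub>k\<close>, then in both remaining cases the last
  \<open>e\<close> generates \<open>M\<close>. When there are no other arcs, this is immediate. When all \<open>d\<^sub>v\<close>
  equal \<open>m\<close>, the relations show that a power of \<open>m\<close> kills \<open>M\<close>, and that the quotient
  \<open>Q\<close> of \<open>M\<close> by the last \<open>e\<close> satisfies \<open>Q = m Q\<close>; hence \<open>Q = 0\<close>.\<close>

subsection \<open>Generators modulo a submodule\<close>

lemma (in Modules.module) span_insert_subspaceE:
  assumes "x \<in> span (insert g L)" "subspace L"
  obtains k l where "l \<in> L" "x = l + scale k g"
proof -
  obtain k where "x - scale k g \<in> L"
    using assms by (metis span_breakdown_eq span_eq_iff)
  then show thesis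
    using that[of "x - scale k g" k] by simp
qed

section \<open>Pairwise coprime diagonal entries\<close>

text \<open>Modulo \<open>L\<close>, \<open>d x\<close> is a multiple of \<open>g\<close> and
  \<open>D\<close> kills \<open>g\<close>, so \<open>d * D\<close> kills \<open>x\<close> and hence
  \<open>g' = g + D x\<close>. Bezout recovers first \<open>D x\<close>, then \<open>g\<close> and
  \<open>x\<close>, from \<open>g'\<close>.\<close>

lemma (in Modules.module) coprime_cyclic_extension:
  assumes L: "subspace L" and g: "scale D g \<in> L" and x: "scale d x \<in> span (insert g L)"
    and ab: "a * D + b * d = 1"
  obtains g' where "scale (d * D) g' \<in> L" "g \<in> span (insert g' L)" "x \<in> span (insert g' L)"
proof -
  obtain k l where l: "l \<in> L" and dx: "scale d x = l + scale k g"
    using x L by (rule span_insert_subspaceE)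
  have dDx: "scale d (scale D x) \<in> L"
  proof -
    have "scale d (scale D x) = scale D (scale d x)"
      by (simp add: mult.commute)
    also have "\<dots> = scale D l + scale k (scale D g)"
      by (simp add: dx scale_right_distrib mult.commute)
    finally show ?thesis
      using L l g by (simp add: subspace_add subspace_scale del: scale_scale)
  qed
  define g' where "g' = g + scale D x"
  let ?S = "span (insert g' L)"
  have LS: "l \<in> ?S" if "l \<in> L" for l
    using that by (simp add: span_base)
  have g'S: "g' \<in> ?S"
    by (simp add: span_base)
  have "scale (d * D) g' = scale d (scale D g) + scale D (scale d (scale D x))"
    by (simp add: g'_def scale_right_distrib ac_simps)
  then have ann: "scale (d * D) g' \<in> L"
    using L g dDx by (simp add: subspace_add subspace_scale del: scale_scale)
  \<comment> \<open>Modulo \<open>L\<close>, the \<open>b * d\<close> part of \<open>D x\<close>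
    vanishes, and the \<open>a * D\<close> part is \<open>a * D\<close> times \<open>g'\<close>,
    because \<open>D\<close> kills \<open>g\<close>.\<close>
  have "scale D x = scale (a * D + b * d) (scale D x)"
    by (simp add: ab)
  also have "\<dots> = scale (a * D) (g' - g) + scale b (scale d (scale D x))"
    by (simp add: g'_def distrib_right scale_left_distrib mult.assoc)
  also have "\<dots> = scale (a * D) g' - scale a (scale D g) + scale b (scale d (scale D x))"
    by (simp add: scale_right_diff_distrib)
  also have "\<dots> \<in> ?S"
    by (rule span_add[OF span_diff[OF span_scale[OF g'S] span_scale[OF LS[OF g]]]
          span_scale[OF LS[OF dDx]]])
  finally have Dx: "scale D x \<in> ?S" .
  have "g = g' - scale D x"
    by (simp add: g'_def)
  then have gS: "g \<in> ?S"
    using Dx g'S by (metis span_diff)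
  have "x = scale (a * D + b * d) x"
    by (simp add: ab)
  also have "\<dots> = scale a (scale D x) + scale b (scale d x)"
    by (simp add: scale_left_distrib)
  also have "\<dots> = scale a (scale D x) + scale b (l + scale k g)"
    by (simp only: dx)
  also have "\<dots> \<in> ?S"
    by (rule span_add[OF span_scale[OF Dx]
          span_scale[OF span_add[OF LS[OF l] span_scale[OF gS]]]])
  finally have "x \<in> ?S" .
  with ann gS that show thesis by blast
qed

lemma (in Modules.module) span_insert_trans:
  assumes "x \<in> span (insert g L)" "g \<in> span (insert g' L)"
  shows "x \<in> span (insert g' L)"
proof -
  have "insert g L \<subseteq> span (insert g' L)"
    using assms(2) by (auto simp: span_base)
  then show ?thesis
    using assms(1) span_minimal subspace_span by blast
qed

text \<open>The annihilator \<open>prod d W\<close> is carried through the induction because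
  adjoining a vertex \<open>w\<close> requires the old annihilator to be coprime to
  \<open>d w\<close>.\<close>

lemma acyclic_coprime_cyclic:
  fixes scale :: "int \<Rightarrow> 'b::ab_group_add \<Rightarrow> 'b" and e :: "'v \<Rightarrow> 'b"
  assumes "Modules.module scale" and L: "Modules.module.subspace scale L"
    and E: "finite E" "acyclic E" and "finite W"
    and closed: "\<And>u v. (u, v) \<in> E \<Longrightarrow> v \<in> W \<Longrightarrow> u \<in> W"
    and rel: "\<And>v. v \<in> W \<Longrightarrow> scale (d v) (e v) + sum e {u. (u, v) \<in> E} \<in> L"
    and cop: "\<And>u v. u \<in> W \<Longrightarrow> v \<in> W \<Longrightarrow> u \<noteq> v \<Longrightarrow> coprime (d u) (d v)"
  shows "\<exists>g. scale (prod d W) g \<in> L \<and> (\<forall>v\<in>W. e v \<in> Modules.module.span scale (insert g L))"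
proof -
  interpret Modules.module scale by fact
  have wf: "wf (E\<inverse>)"
    using E by (rule finite_acyclic_wf_converse)
  show ?thesis
    using \<open>finite W\<close> closed rel cop
  proof (induction W rule: finite_psubset_induct)
    case (psubset W)
    show ?case
    proof (cases "W = {}")
      case True
      then show ?thesis
        using subspace_0[OF L] by (intro exI[of _ 0]) simp
    next
      case False
      \<comment> \<open>A sink of \<open>W\<close> can be removed without losing closure under
        predecessors, and all its own predecessors stay in the smaller set.\<close>
      then obtain w where w: "w \<in> W" and sink: "\<And>v. (w, v) \<in> E \<Longrightarrow> v \<notin> W"
        using wfE_min[OF wf, of _ W] by (metis converseI ex_in_conv)
      let ?W = "W - {w}"
      have "\<exists>g. scale (prod d ?W) g \<in> L \<and> (\<forall>v\<in>?W. e v \<in> span (insert g L))"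
      proof (rule psubset.IH)
        show "u \<in> ?W" if "(u, v) \<in> E" "v \<in> ?W" for u v
          using that sink psubset.prems(1) by blast
      qed (use w psubset.prems(2,3) in auto)
      then obtain g where g: "scale (prod d ?W) g \<in> L"
        and gen: "\<And>v. v \<in> ?W \<Longrightarrow> e v \<in> span (insert g L)"
        by blast
      have "coprime (prod d ?W) (d w)"
        using w psubset.prems(3) by (intro prod_coprime_left) auto
      then obtain a b where ab: "a * prod d ?W + b * d w = 1"
        using bezout_int[of "prod d ?W" "d w"] by auto
      have "{u. (u, w) \<in> E} \<subseteq> ?W"
        using w sink psubset.prems(1) by blast
      then have "sum e {u. (u, w) \<in> E} \<in> span (insert g L)"
        using gen by (intro span_sum) blast
      moreover have "scale (d w) (e w) + sum e {u. (u, w) \<in> E} \<in> span (insert g L)"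
        using psubset.prems(2)[OF w] by (simp add: span_base)
      ultimately have "scale (d w) (e w) \<in> span (insert g L)"
        by (simp add: span_add_eq2)
      then obtain g' where "scale (d w * prod d ?W) g' \<in> L"
        and gg': "g \<in> span (insert g' L)" and "e w \<in> span (insert g' L)"
        using coprime_cyclic_extension[OF L g _ ab] by blast
      moreover have "d w * prod d ?W = prod d W"
        using psubset.hyps w by (simp add: prod.remove)
      moreover have "e v \<in> span (insert g' L)" if "v \<in> ?W" for v
        using gen[OF that] gg' by (rule span_insert_trans)
      ultimately show ?thesis
        by (intro exI[of _ g']) auto
    qed
  qed
qed

section \<open>Generators from Hamiltonian paths\<close>

text \<open>A Nakayama argument modulo \<open>S\<close>, with \<open>P k\<close> in the role of the
  predecessors of \<open>v k\<close>. The triangular shape of the relations makes \<open>m\<close>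
  nilpotent on the \<open>e (v k)\<close>; the arcs of the path then allow division by
  \<open>m\<close>.\<close>

lemma (in Modules.module) hamiltonian_path_generator:
  assumes S: "subspace S" "e (v (n - 1)) \<in> S"
    and rel: "\<And>k. k < n \<Longrightarrow> scale m (e (v k)) + sum e (P k) \<in> S"
    and arc: "\<And>k. Suc k < n \<Longrightarrow> v k \<in> P (Suc k)"
    and P: "\<And>k. k < n \<Longrightarrow> P k \<subseteq> v ` {..<k}"
    and "k < n"
  shows "e (v k) \<in> S"
proof -
  \<comment> \<open>Every exponent above \<open>k\<close> is allowed, so that one exponent
    \<open>s\<close> serves all predecessors at once.\<close>
  have kill: "scale (m ^ t) (e (v k)) \<in> S" if "k < t" "k < n" for k t
    using that
  proof (induction k arbitrary: t rule: less_induct)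
    case (less k)
    then obtain s where t: "t = Suc s"
      by (cases t) auto
    have IH: "scale (m ^ s) (e u) \<in> S" if u: "u \<in> P k" for u
    proof -
      obtain i where "i < k" "u = v i"
        using u P[OF less.prems(2)] by blast
      then show ?thesis
        using less.IH[of i s] less.prems t by simp
    qed
    have "scale (m ^ t) (e (v k)) =
        scale (m ^ s) (scale m (e (v k)) + sum e (P k)) - (\<Sum>u\<in>P k. scale (m ^ s) (e u))"
      by (simp add: t scale_right_distrib scale_sum_right mult.commute)
    also have "\<dots> \<in> S"
      using less.prems(2) IH
      by (intro subspace_diff[OF S(1)] subspace_scale[OF S(1) rel] subspace_sum[OF S(1)])
    finally show ?case .
  qed
  \<comment> \<open>Lower the exponent of \<open>m\<close> from \<open>n\<close> to \<open>0\<close>: the relation at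
    \<open>v (Suc k)\<close> expresses \<open>e (v k)\<close> by \<open>m e (v (Suc k))\<close> and earlier vertices.\<close>
  have "\<forall>k<n. scale (m ^ (n - t)) (e (v k)) \<in> S" if "t \<le> n" for t
    using that
  proof (induction t)
    case 0
    then show ?case using kill by simp
  next
    case (Suc t)
    define s where "s = n - Suc t"
    have s: "n - t = Suc s"
      using Suc.prems by (simp add: s_def)
    \<comment> \<open>The outer hypothesis covers the later vertex \<open>v (Suc k)\<close> at
      exponent \<open>Suc s\<close>; the inner induction covers the earlier vertices at exponent
      \<open>s\<close>.\<close>
    have "scale (m ^ s) (e (v k)) \<in> S" if "k < n" for k
      using that
    proof (induction k rule: less_induct)
      case (less k)
      show ?case
      proof (cases "Suc k < n")
        case False
        then have "k = n - 1"
          using less.prems by simp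
        then show ?thesis
          using S by (simp add: subspace_scale)
      next
        case True
        let ?P = "P (Suc k)"
        have fin: "finite ?P"
          using P[OF True] by (rule finite_subset) simp
        have IH: "scale (m ^ s) (e u) \<in> S" if u: "u \<in> ?P - {v k}" for u
        proof -
          obtain i where "i < Suc k" "u = v i"
            using u P[OF True] by blast
          moreover from this have "i \<noteq> k"
            using u by auto
          ultimately show ?thesis
            using less.IH[of i] less.prems by simp
        qed
        have "sum e ?P = e (v k) + sum e (?P - {v k})"
          using arc[OF True] fin by (simp add: sum.remove)
        then have "scale (m ^ s) (e (v k)) =
            scale (m ^ s) (scale m (e (v (Suc k))) + sum e ?P)
            - scale (m ^ Suc s) (e (v (Suc k))) - (\<Sum>u\<in>?P - {v k}. scale (m ^ s) (e u))"
          by (simp add: scale_right_distrib scale_sum_right mult.commute)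
        also have "\<dots> \<in> S"
        proof (intro subspace_diff[OF S(1)])
          show "scale (m ^ s) (scale m (e (v (Suc k))) + sum e ?P) \<in> S"
            using rel[OF True] by (rule subspace_scale[OF S(1)])
          show "scale (m ^ Suc s) (e (v (Suc k))) \<in> S"
            using Suc True s by simp
          show "(\<Sum>u\<in>?P - {v k}. scale (m ^ s) (e u)) \<in> S"
            using IH by (rule subspace_sum[OF S(1)])
        qed
        finally show ?thesis .
      qed
    qed
    then show ?case
      by (simp add: s_def)
  qed
  from this[of n] show ?thesis
    using \<open>k < n\<close> by simp
qed

text \<open>Going backwards from the last vertex, each relation writes \<open>e k\<close> modulo
  \<open>S\<close> as a multiple of \<open>e (Suc k)\<close>.\<close>

lemma (in Modules.module) path_generator:
  assumes S: "subspace S" "e (n - 1) \<in> S"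
    and rel: "\<And>k. Suc k < n \<Longrightarrow> scale (d k) (e (Suc k)) + e k \<in> S"
    and "k < n"
  shows "e k \<in> S"
proof -
  have "k \<le> n - 1"
    using \<open>k < n\<close> by simp
  then show ?thesis
  proof (induction k rule: inc_induct)
    case base
    then show ?case by (rule S(2))
  next
    case (step k)
    then have "scale (d k) (e (Suc k)) + e k \<in> S"
      using rel by simp
    from subspace_diff[OF S(1) this subspace_scale[OF S(1) step.IH, of "d k"]]
    show ?case by simp
  qed
qed

subsection \<open>Walks visiting all vertices\<close>

lemma set_vwalk_arcs: "set (vwalk_arcs p) = {(p ! k, p ! Suc k) | k. Suc k < length p}"
proof (induction p rule: vwalk_arcs.induct)
  case (3 x y xs)
  let ?R = "\<lambda>p. {(p ! k, p ! Suc k) | k. Suc k < length p}"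
  have "?R (x # y # xs) = insert (x, y) (?R (y # xs))"
  proof (intro equalityI subsetI)
    fix a assume "a \<in> ?R (x # y # xs)"
    then obtain k where "Suc k < length (x # y # xs)"
      "a = ((x # y # xs) ! k, (x # y # xs) ! Suc k)" by blast
    then show "a \<in> insert (x, y) (?R (y # xs))"
      by (cases k) auto
  next
    fix a assume "a \<in> insert (x, y) (?R (y # xs))"
    then consider "a = (x, y)"
      | k where "Suc k < length (y # xs)" "a = ((y # xs) ! k, (y # xs) ! Suc k)" by blast
    then show "a \<in> ?R (x # y # xs)"
    proof cases
      case 1
      then show ?thesis by (intro CollectI exI[of _ 0]) simp
    next
      case 2
      then show ?thesis by (intro CollectI exI[of _ "Suc k"]) simp
    qed
  qed
  with 3 show ?case by simp
qed auto

lemma walk_nth_trancl: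
  assumes "\<And>k. Suc k < length p \<Longrightarrow> (p ! k, p ! Suc k) \<in> E" "i < j" "j < length p"
  shows "(p ! i, p ! j) \<in> E\<^sup>+"
proof -
  have "Suc i \<le> j" using assms(2) by simp
  then show ?thesis using assms(3)
  proof (induction j rule: dec_induct)
    case base
    then show ?case using assms(1) by auto
  next
    case (step j)
    then show ?case using assms(1)[of j] by (auto intro: trancl_into_trancl)
  qed
qed

text \<open>The stretch of the walk between two occurrences of a vertex would be a cycle.\<close>

lemma acyclic_walk_distinct:
  assumes "\<And>k. Suc k < length p \<Longrightarrow> (p ! k, p ! Suc k) \<in> E" "acyclic E"
  shows "distinct p"
  unfolding distinct_conv_nth
  using walk_nth_trancl[OF assms(1)] assms(2)
  by (metis acyclic_def linorder_neqE_nat)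

subsection \<open>The cokernel of an integer matrix\<close>

lemma subgroup_image_mult_mat_vec:
  fixes A :: "int mat"
  shows "subgroup ((\<lambda>x. A *\<^sub>v x) ` carrier_vec (dim_col A)) (monoid_vec TYPE(int) (dim_row A))"
proof -
  have A: "A \<in> carrier_mat (dim_row A) (dim_col A)" by simp
  interpret h: group_hom "monoid_vec TYPE(int) (dim_col A)" "monoid_vec TYPE(int) (dim_row A)"
    "\<lambda>x. A *\<^sub>v x"
  proof (intro group_hom.intro group_hom_axioms.intro)
    show "(\<lambda>x. A *\<^sub>v x)
        \<in> hom (monoid_vec TYPE(int) (dim_col A)) (monoid_vec TYPE(int) (dim_row A))"
      using mult_mat_vec_carrier[OF A]
      by (auto simp: hom_def monoid_vec_simps mult_add_distrib_mat_vec[OF A])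
  qed (rule comm_group.axioms(2)[OF comm_group_vec])+
  show ?thesis
    using h.img_is_subgroup by (simp add: monoid_vec_simps)
qed

text \<open>The map sending \<open>k\<close> to the coset of \<open>k \<cdot>\<^sub>v g\<close> is
  then an epimorphism from the integers onto the cokernel.\<close>

lemma cyclic_cokernelI:
  fixes A :: "int mat"
  assumes g: "g \<in> carrier_vec (dim_row A)"
    and gen: "\<And>x. x \<in> carrier_vec (dim_row A) \<Longrightarrow>
      \<exists>k. \<exists>y\<in>carrier_vec (dim_col A). x = A *\<^sub>v y + k \<cdot>\<^sub>v g"
  shows "cyclic_group (cokernel A)"
proof -
  let ?H = "(\<lambda>x. A *\<^sub>v x) ` carrier_vec (dim_col A)"
  let ?V = "monoid_vec TYPE(int) (dim_row A)"
  interpret V: comm_group ?V by (rule comm_group_vec)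
  interpret H: normal ?H ?V
    by (rule V.subgroup_imp_normal[OF subgroup_image_mult_mat_vec])
  let ?h = "\<lambda>k::int. ?H #>\<^bsub>?V\<^esub> (k \<cdot>\<^sub>v g)"
  have g': "k \<cdot>\<^sub>v g \<in> carrier ?V" for k
    using g by (simp add: monoid_vec_simps)
  have "?h \<in> hom integer_group (cokernel A)"
  proof (rule homI)
    show "?h k \<in> carrier (cokernel A)" for k
      using g' by (auto simp: cokernel_def FactGroup_def RCOSETS_def)
    show "?h (k \<otimes>\<^bsub>integer_group\<^esub> l) = ?h k \<otimes>\<^bsub>cokernel A\<^esub> ?h l" for k l
      using H.rcos_sum[OF g' g', of k l]
      by (simp add: cokernel_def FactGroup_def monoid_vec_simps add_smult_distrib_vec)
  qed
  moreover have "?h ` carrier integer_group = carrier (cokernel A)"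
  proof (intro equalityI subsetI)
    fix c assume "c \<in> carrier (cokernel A)"
    then obtain x where x: "x \<in> carrier ?V" "c = ?H #>\<^bsub>?V\<^esub> x"
      by (auto simp: cokernel_def FactGroup_def RCOSETS_def)
    then obtain k y where y: "y \<in> carrier_vec (dim_col A)" "x = A *\<^sub>v y + k \<cdot>\<^sub>v g"
      using gen by (metis monoid_vec_simps(2))
    then have "x \<in> ?h k"
      by (auto simp: r_coset_def monoid_vec_simps)
    then have "c = ?h k"
      using V.repr_independence[OF _ g' subgroup_image_mult_mat_vec] x by auto
    then show "c \<in> ?h ` carrier integer_group"
      by auto
  qed (use \<open>?h \<in> hom _ _\<close> in \<open>auto simp: hom_def\<close>)
  ultimately have "?h \<in> epi integer_group (cokernel A)"
    by (simp add: epi_def)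
  then show ?thesis
    using group.cyclic_group_epimorphic_image[OF group_integer_group _ cyclic_integer_group]
      comm_group_cokernel comm_group.axioms(2) by blast
qed

text \<open>Vectors do not form a module type, so the argument is carried out in the module of functions
  \<^typ>\<open>nat \<Rightarrow> int\<close>, with the preimage of the column lattice under \<^term>\<open>vec n\<close>.\<close>

definition scale_fun :: "int \<Rightarrow> (nat \<Rightarrow> int) \<Rightarrow> nat \<Rightarrow> int" where
  "scale_fun c f = (\<lambda>i. c * f i)"

interpretation scale_fun: Modules.module scale_fun
  by standard (auto simp: scale_fun_def fun_eq_iff algebra_simps)

text \<open>The standard basis vector whose class in the cokernel is the generator
  \<open>e\<^sub>v\<close>.\<close>

definition vertex_fun :: "nat \<Rightarrow> nat \<Rightarrow> int" where
  "vertex_fun v = (\<lambda>i. if Suc i = v then 1 else 0)"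

text \<open>Values at indices from \<open>dim_row A\<close> on are unconstrained, so the functions
  modulo this set are exactly the cokernel.\<close>

definition column_lattice :: "int mat \<Rightarrow> (nat \<Rightarrow> int) set" where
  "column_lattice A = {f. vec (dim_row A) f \<in> (\<lambda>x. A *\<^sub>v x) ` carrier_vec (dim_col A)}"

lemma subspace_column_lattice: "scale_fun.subspace (column_lattice A)"
proof (rule scale_fun.subspaceI)
  have A: "A \<in> carrier_mat (dim_row A) (dim_col A)" by simp
  have "vec (dim_row A) (0 :: nat \<Rightarrow> int) = A *\<^sub>v 0\<^sub>v (dim_col A)"
    by (intro eq_vecI) auto
  then show "0 \<in> column_lattice A"
    by (auto simp: column_lattice_def)
  fix f assume "f \<in> column_lattice A"
  then obtain x where x: "x \<in> carrier_vec (dim_col A)" "vec (dim_row A) f = A *\<^sub>v x"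
    by (auto simp: column_lattice_def)
  {
    fix c
    have "vec (dim_row A) (scale_fun c f) = c \<cdot>\<^sub>v vec (dim_row A) f"
      by (intro eq_vecI) (auto simp: scale_fun_def)
    also have "\<dots> = A *\<^sub>v (c \<cdot>\<^sub>v x)"
      using x(1) unfolding x(2) by (intro eq_vecI) auto
    finally show "scale_fun c f \<in> column_lattice A"
      using x by (auto simp: column_lattice_def)
  next
    fix g assume "g \<in> column_lattice A"
    then obtain y where y: "y \<in> carrier_vec (dim_col A)" "vec (dim_row A) g = A *\<^sub>v y"
      by (auto simp: column_lattice_def)
    have "vec (dim_row A) (f + g) = vec (dim_row A) f + vec (dim_row A) g"
      by (intro eq_vecI) auto
    also have "\<dots> = A *\<^sub>v (x + y)"
      using x y mult_add_distrib_mat_vec[OF A x(1) y(1)] by simp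
    finally show "f + g \<in> column_lattice A"
      using x y by (auto simp: column_lattice_def)
  }
qed

lemma sum_fun_apply: "sum f A x = (\<Sum>a\<in>A. f a x)"
  by (induction A rule: infinite_finite_induct) auto

lemma cyclic_cokernel_if_vertices_spanned:
  assumes A: "A \<in> carrier_mat n n"
    and gen: "\<And>v. v \<in> {1..n} \<Longrightarrow>
      vertex_fun v \<in> scale_fun.span (insert g (column_lattice A))"
  shows "cyclic_group (cokernel A)"
proof (rule cyclic_cokernelI)
  show "vec n g \<in> carrier_vec (dim_row A)"
    using A by simp
  fix x :: "int vec" assume "x \<in> carrier_vec (dim_row A)"
  then have x: "x \<in> carrier_vec n"
    using A by simp
  \<comment> \<open>\<open>?f\<close> extends \<open>x\<close> by zero to a function and lies in the
    span of the vertex functions; splitting it into a lattice part and a multiple of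
    \<open>g\<close> splits \<open>x\<close> likewise.\<close>
  let ?f = "\<Sum>v\<in>{1..n}. scale_fun (x $ (v - 1)) (vertex_fun v)"
  have f: "?f i = x $ i" if "i < n" for i
  proof -
    have "?f i = (\<Sum>v\<in>{1..n}. scale_fun (x $ (v - 1)) (vertex_fun v) i)"
      by (rule sum_fun_apply)
    also have "\<dots> = (\<Sum>v\<in>{1..n}. if v = Suc i then x $ i else 0)"
      by (intro sum.cong) (auto simp: scale_fun_def vertex_fun_def)
    also have "\<dots> = x $ i"
      using that by simp
    finally show ?thesis .
  qed
  have "?f \<in> scale_fun.span (insert g (column_lattice A))"
    using gen by (intro scale_fun.span_sum scale_fun.span_scale) auto
  then obtain l k where l: "l \<in> column_lattice A" and fl: "?f = l + scale_fun k g"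
    using subspace_column_lattice by (rule scale_fun.span_insert_subspaceE)
  have "x $ i = l i + k * g i" if "i < n" for i
    using f[OF that] by (simp only: fl) (simp add: scale_fun_def)
  then have "x = vec n l + k \<cdot>\<^sub>v vec n g"
    using x by (intro eq_vecI) auto
  then show "\<exists>k. \<exists>y\<in>carrier_vec (dim_col A). x = A *\<^sub>v y + k \<cdot>\<^sub>v vec n g"
    using l A unfolding column_lattice_def by (intro exI[of _ k]) (auto simp: image_iff)
qed

text \<open>This is the column of the matrix at \<open>v\<close>, the image of a unit vector. An arc
  \<open>(u, v)\<close> has its 1 in row \<open>u\<close> of that column, so the sum runs over
  predecessors.\<close>

lemma vertex_relation:
  assumes E: "finite (parcs G)" "parcs G \<subseteq> {1..n} \<times> {1..n}" and v: "v \<in> {1..n}"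
  shows "scale_fun (d v) (vertex_fun v) + sum vertex_fun {u. (u, v) \<in> parcs G}
    \<in> column_lattice (graphical_simplex n d G)"
proof -
  let ?A = "graphical_simplex n d G" and ?P = "{u. (u, v) \<in> parcs G}"
  let ?f = "scale_fun (d v) (vertex_fun v) + sum vertex_fun ?P"
  have A: "dim_row ?A = n" "dim_col ?A = n"
    using graphical_simplex_carrier[of n d G] by auto
  have fin: "finite ?P"
    by (rule finite_subset[of _ "fst ` parcs G"]) (auto intro: rev_image_eqI simp: E)
  have "?f i = ?A $$ (i, v - 1)" if "i < n" for i
  proof -
    have "sum vertex_fun ?P i = (\<Sum>u\<in>?P. if u = Suc i then 1 else 0)"
      unfolding sum_fun_apply by (intro sum.cong) (auto simp: vertex_fun_def)
    also have "\<dots> = (if (Suc i, v) \<in> parcs G then 1 else 0)"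
      using fin by simp
    finally show ?thesis
      using v that E(1) by (auto simp: graphical_simplex_index scale_fun_def vertex_fun_def)
  qed
  then have "vec n ?f = ?A *\<^sub>v unit_vec n (v - 1)"
    using A v by (intro eq_vecI) auto
  then show ?thesis
    using A by (auto simp: column_lattice_def)
qed

section \<open>The three sufficient conditions\<close>

theorem theorem3p1:
  fixes n :: nat and d :: "nat \<Rightarrow> int" and G :: "nat pair_pre_digraph"
  assumes "n \<ge> 1"
    and "pair_digraph G" and "pverts G = {1..n}" and "acyclic (parcs G)"
    and "\<forall>i\<in>{1..n}. d i \<ge> 1"
    and "(\<forall>i\<in>{1..n}. \<forall>j\<in>{1..n}. i \<noteq> j \<longrightarrow> coprime (d i) (d j))
       \<or> is_directed_path G (n - 1)
       \<or> (contains_directed_path G (n - 1) \<and> (\<exists>m\<ge>1. \<forall>i\<in>{1..n}. d i = m))"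
  shows "cyclic_group (cokernel (graphical_simplex n d G))"
proof -
  interpret pair_digraph G by fact
  let ?A = "graphical_simplex n d G" and ?E = "parcs G"
  let ?L = "column_lattice ?A"
  have E: "finite ?E" "?E \<subseteq> {1..n} \<times> {1..n}"
    using assms(3) pair_finite_arcs in_arcsD1 in_arcsD2 by auto
  have rel: "scale_fun (d v) (vertex_fun v) + sum vertex_fun {u. (u, v) \<in> ?E} \<in> ?L"
    if "v \<in> {1..n}" for v
    using E that by (rule vertex_relation)
  note cyclicI = cyclic_cokernel_if_vertices_spanned[OF graphical_simplex_carrier]
  \<comment> \<open>Membership in this submodule means vanishing in the quotient of the cokernel by
    the class of \<open>g\<close>; it serves as \<open>S\<close> in both path cases.\<close>
  have span: "scale_fun.subspace (scale_fun.span (insert g ?L))"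
      "g \<in> scale_fun.span (insert g ?L)" "?L \<subseteq> scale_fun.span (insert g ?L)" for g
    by (auto simp: scale_fun.span_base)
  consider "\<forall>i\<in>{1..n}. \<forall>j\<in>{1..n}. i \<noteq> j \<longrightarrow> coprime (d i) (d j)"
    | "is_directed_path G (n - 1)"
    | m where "contains_directed_path G (n - 1)" "\<forall>i\<in>{1..n}. d i = m"
    using assms(6) by blast
  then show ?thesis
  proof cases
    case 1
    have "\<exists>g. scale_fun (prod d {1..n}) g \<in> ?L \<and>
        (\<forall>v\<in>{1..n}. vertex_fun v \<in> scale_fun.span (insert g ?L))"
      using scale_fun.module_axioms subspace_column_lattice E(1) assms(4) finite_atLeastAtMost
        _ rel
    proof (rule acyclic_coprime_cyclic)
      show "u \<in> {1..n}" if "(u, v) \<in> ?E" for u v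
        using that E(2) by blast
      show "coprime (d u) (d v)" if "u \<in> {1..n}" "v \<in> {1..n}" "u \<noteq> v" for u v
        using 1 that by blast
    qed
    then show ?thesis
      using cyclicI by blast
  next
    case 2
    then obtain p where p: "distinct p" "p \<noteq> []" "length p - 1 = n - 1" "set p = {1..n}"
      and arcs: "?E = {(p ! k, p ! Suc k) | k. Suc k < length p}"
      by (auto simp: is_directed_path_def vpath_def vwalk_def assms(3) set_vwalk_arcs)
    have len: "length p = n"
      using p distinct_card by fastforce
    show ?thesis
    proof (rule cyclicI)
      fix v assume "v \<in> {1..n}"
      then obtain k where "k < n" "v = p ! k"
        using p(4) len by (metis in_set_conv_nth)
      moreover have "vertex_fun (p ! k)
          \<in> scale_fun.span (insert (vertex_fun (p ! (n - 1))) ?L)"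
      \<comment> \<open>The shift by one is due to using the relation at the head
        \<open>p ! Suc k\<close> of each arc.\<close>
      proof (rule scale_fun.path_generator[OF span(1,2), where d = "\<lambda>k. d (p ! Suc k)"])
        fix k assume k: "Suc k < n"
        \<comment> \<open>There are no arcs off the path and no repeated vertices, so the
          predecessor is unique.\<close>
        then have "{u. (u, p ! Suc k) \<in> ?E} = {p ! k}"
          using p(1) len by (auto simp: arcs nth_eq_iff_index_eq)
        moreover have "p ! Suc k \<in> {1..n}"
          using k p(4) len nth_mem by blast
        ultimately show "scale_fun (d (p ! Suc k)) (vertex_fun (p ! Suc k)) + vertex_fun (p ! k)
            \<in> scale_fun.span (insert (vertex_fun (p ! (n - 1))) ?L)"
          using rel[of "p ! Suc k"] span(3) by auto
      qed fact
      ultimately show "vertex_fun v \<in> scale_fun.span (insert (vertex_fun (p ! (n - 1))) ?L)"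
        by simp
    qed
  next
    case 3
    then obtain p where p: "p \<noteq> []" "length p - 1 = n - 1" "set p \<subseteq> {1..n}"
      and arcs: "{(p ! k, p ! Suc k) | k. Suc k < length p} \<subseteq> ?E"
      by (auto simp: contains_directed_path_def vwalk_def assms(3) set_vwalk_arcs)
    \<comment> \<open>Natural subtraction truncates, so cancelling the 1 uses that \<open>p\<close>
      is nonempty and \<open>n\<close> is positive.\<close>
    have len: "length p = n"
      using p \<open>n \<ge> 1\<close> by (cases p) auto
    have arc: "(p ! k, p ! Suc k) \<in> ?E" if "Suc k < length p" for k
      using arcs that by blast
    have "distinct p"
      using arc assms(4) by (rule acyclic_walk_distinct)
    then have "set p = {1..n}"
      using p(3) len by (intro card_subset_eq) (auto simp: distinct_card)
    then have onto: "\<exists>k<n. v = p ! k" if "v \<in> {1..n}" for v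
      using that len by (metis in_set_conv_nth)
    show ?thesis
    proof (rule cyclicI)
      fix v assume "v \<in> {1..n}"
      then obtain k where "k < n" "v = p ! k"
        using onto by blast
      moreover have "vertex_fun (p ! k)
          \<in> scale_fun.span (insert (vertex_fun (p ! (n - 1))) ?L)"
      proof (rule scale_fun.hamiltonian_path_generator[OF span(1,2),
            where m = m and P = "\<lambda>k. {u. (u, p ! k) \<in> ?E}" and v = "\<lambda>k. p ! k"])
        show "p ! k \<in> {u. (u, p ! Suc k) \<in> ?E}" if "Suc k < n" for k
          using arc that len by simp
      next
        fix k assume k: "k < n"
        then have pk: "p ! k \<in> {1..n}"
          using p(3) len nth_mem by blast
        then show "scale_fun m (vertex_fun (p ! k)) + sum vertex_fun {u. (u, p ! k) \<in> ?E}
            \<in> scale_fun.span (insert (vertex_fun (p ! (n - 1))) ?L)"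
          using rel[of "p ! k"] span(3) 3(2) by auto
        \<comment> \<open>The Hamiltonian path is a topological order: an arc from position
          \<open>k\<close> or later back to \<open>p ! k\<close> would close a cycle with a stretch
          of the path, or be a loop.\<close>
        show "{u. (u, p ! k) \<in> ?E} \<subseteq> (\<lambda>k. p ! k) ` {..<k}"
        proof
          fix u assume "u \<in> {u. (u, p ! k) \<in> ?E}"
          then have u: "(u, p ! k) \<in> ?E" by simp
          then obtain i where i: "i < n" "u = p ! i"
            using onto E(2) by blast
          have "i < k"
          proof (rule ccontr)
            assume "\<not> i < k"
            then have "(p ! k, p ! i) \<in> ?E\<^sup>*"
              using walk_nth_trancl[OF arc, of k i] i len
              by (cases "i = k") (auto intro: trancl_into_rtrancl)
            then have "(p ! k, p ! k) \<in> ?E\<^sup>+"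
              using u i by (metis rtrancl_into_trancl1)
            then show False
              using assms(4) by (auto simp: acyclic_def)
          qed
          then show "u \<in> (\<lambda>k. p ! k) ` {..<k}"
            using i by blast
        qed
      qed fact
      ultimately show "vertex_fun v \<in> scale_fun.span (insert (vertex_fun (p ! (n - 1))) ?L)"
        by simp
    qed
  qed
qed

end
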